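(* Let $M$ be a (nonempty) compact metric space, $f\colon M\to M$ a continuous map, $X=(X,\lVert\cdot\rVert)$ a separable Banach space, and $\mathcal{A}\colon M\times\mathbb{N}_0\to B(X)$ a cocycle over $f$. Let $\mu$ be any ergodic $f$-invariant Borel probability measure on $M$, and let $\lambda_\mu(\mathcal{A})\in[-\infty,\infty)$ be the largest Lyapunov exponent of $\mathcal{A}$ with respect to $\mu$. Then the following properties are equivalent: (1) there exist a Borel-measurable function $C\colon M\to(0,\infty)$ and $p>0$ such that for $\mu$-a.e. $q\in M$ and every $x\in X$, \[ \bigg(\sum_{n=0}^\infty \lVert \mathcal{A}(q,n)x\rVert^p\bigg)^{1/p}\le C(q)\lVert x\rVert; \] (2) $\lambda_\mu(\mathcal{A})<0$.
   Context: $\mathbb{N}_0=\{0,1,2,\ldots\}$ and $B(X)$ is the space of all bounded linear operators on $X$. A map $\mathcal{A}\colon M\times\mathbb{N}_0\to B(X)$ is a cocycle over $f$ if: (i) $\mathcal{A}(q,0)=\mathrm{Id}$ for each $q\in M$; (ii) $\mathcal{A}(q,n+m)=\mathcal{A}(f^m(q),n)\mathcal{A}(q,m)$ for each $q\in M$ and $n,m\in\mathbb{N}_0$; (iii) the map $A\colon M\to B(X)$, $A(q)=\mathcal{A}(q,1)$ (the generator of $\mathcal{A}$), is strongly continuous, i.e. $q\mapsto A(q)x$ is continuous for each $x\in X$. Under these assumptions $q\mapsto\lVert\mathcal{A}(q,n)\rVert$ is Borel-measurable for each $n$ and $\sup_{q\in M}\lVert A(q)\rVert<\infty$, so by Kingman's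 subadditive ergodic theorem, for each ergodic $f$-invariant Borel probability measure $\mu$ there is a number $\lambda_\mu(\mathcal{A})\in[-\infty,\infty)$ with \[ \lambda_\mu(\mathcal{A})=\lim_{n\to\infty}\frac1n\log\lVert\mathcal{A}(q,n)\rVert\quad\text{for }\mu\text{-a.e. }q\in M \] (convention $\log 0=-\infty$). It is called the largest Lyapunov exponent of $\mathcal{A}$ with respect to $\mu$. *)

theory Defs
  imports "HOL-Analysis.Analysis" "HOL-Probability.Probability"
begin

definition cocycle ::
  "('m::topological_space \<Rightarrow> 'm) \<Rightarrow> ('m \<Rightarrow> nat \<Rightarrow> ('x::real_normed_vector \<Rightarrow>\<^sub>L 'x)) \<Rightarrow> bool"
where
  "cocycle f A \<longleftrightarrow>
     (\<forall>q. A q 0 = id_blinfun) \<and>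
     (\<forall>q n m. A q (n + m) = A ((f ^^ m) q) n o\<^sub>L A q m) \<and>
     (\<forall>x. continuous_on UNIV (\<lambda>q. blinfun_apply (A q 1) x))"

definition invariant_prob :: "('m::topological_space \<Rightarrow> 'm) \<Rightarrow> 'm measure \<Rightarrow> bool" where
  "invariant_prob f \<mu> \<longleftrightarrow>
     prob_space \<mu> \<and> sets \<mu> = sets borel \<and> f \<in> measurable \<mu> \<mu> \<and> distr \<mu> \<mu> f = \<mu>"

definition ergodic_prob :: "('m::topological_space \<Rightarrow> 'm) \<Rightarrow> 'm measure \<Rightarrow> bool" where
  "ergodic_prob f \<mu> \<longleftrightarrow>
     invariant_prob f \<mu> \<and>
     (\<forall>E\<in>sets \<mu>. f -` E = E \<longrightarrow> measure \<mu> E = 0 \<or> measure \<mu> E = 1)"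

text \<open>Logarithm on \<open>[0,\<infinity>)\<close> with \<open>log 0 = -\<infinity>\<close> (the library has \<open>ln 0 = 0\<close>).\<close>

definition elog :: "real \<Rightarrow> ereal" where
  "elog r = (if r = 0 then -\<infinity> else ereal (ln r))"

text \<open>
  When \<open>A\<close> is a cocycle over \<open>f\<close> (with compact base and separable fibre) and \<open>\<mu>\<close> is ergodic,
  exactly one value satisfies the description below: existence is Kingman's
  subadditive ergodic theorem, and uniqueness holds because limits are unique and a probability
  space is not a null set.
\<close>

definition largest_lyapunov_exponent ::
  "'m measure \<Rightarrow> ('m \<Rightarrow> nat \<Rightarrow> ('x::real_normed_vector \<Rightarrow>\<^sub>L 'x)) \<Rightarrow> ereal"
where
  "largest_lyapunov_exponent \<mu> A =
     (THE l. l < \<infinity> \<and>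
        (AE q in \<mu>. (\<lambda>n. ereal (1 / real n) * elog (norm (A q n))) \<longlonglongrightarrow> l))"

end

theory Submission
  imports Defs "HOL-Real_Asymp.Real_Asymp"
begin

text \<open>Existence of the exponent is Kingman's theorem, proved by greedily cutting orbit segments into
  pieces on which the norm is close to its smallest growth rate; the exceptional pieces are rare by
  an upper Birkhoff bound, which is the same greedy argument applied to a counting function.

  If \<open>\<lambda> < 0\<close> then \<open>|A(q,n)|\<close> is almost surely summable, which gives (1)
  with \<open>p = 1\<close>. Conversely, let \<open>S = {C \<le> R}\<close> have measure above one half. Along the
  orbit of a typical point the norm contracts by a fixed factor whenever a fixed number of
  visits to \<open>S\<close> has been made, and the visits have positive frequency, so the norm decays
  exponentially.\<close>

section \<open>Strongly continuous cocycles\<close>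

text \<open>By Baire's theorem one of the closed sets \<open>F n\<close> contains a ball, and
  linearity spreads the bound on it to the whole space. The indices will be the points of the
  base.\<close>

lemma uniform_boundedness:
  fixes T :: "'i \<Rightarrow> 'x::banach \<Rightarrow>\<^sub>L 'y::real_normed_vector"
  assumes "\<And>x. \<exists>K. \<forall>i. norm (T i x) \<le> K"
  shows "\<exists>K. \<forall>i. norm (T i) \<le> K"
proof -
  define F where "F n = {x. \<forall>i. norm (T i x) \<le> real n}" for n
  have closed: "closed (F n)" for n
  proof -
    have "F n = (\<Inter>i. {x. norm (T i x) \<le> real n})"
      by (auto simp: F_def)
    then show ?thesis
      by (auto intro!: closed_INT closed_Collect_le continuous_intros)
  qed
  have "(\<Union>n. F n) = UNIV"
  proof (intro equalityI subset_UNIV subsetI)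
    fix x
    obtain K where "\<forall>i. norm (T i x) \<le> K" using assms by blast
    moreover obtain n :: nat where "K \<le> real n" using real_arch_simple by blast
    ultimately have "x \<in> F n" by (auto simp: F_def intro: order_trans)
    then show "x \<in> (\<Union>n. F n)" by blast
  qed
  then have "euclidean interior_of \<Union>(range F) \<noteq> {}"
    by simp
  then obtain n where "interior (F n) \<noteq> {}"
    using Baire_category_alt[of euclidean "range F"] closed completely_metrizable_space_euclidean
    by (metis closed_closedin countable_image countableI_type euclidean_interior_of rangeE)
  then obtain x where "x \<in> interior (F n)" by blast
  then obtain r where "r > 0" and r: "cball x r \<subseteq> F n"
    by (meson mem_interior_cball)
  have "norm (T i) \<le> 2 * real n / r" for i
  proof (rule norm_blinfun_bound)
    fix y
    show "norm (T i y) \<le> 2 * real n / r * norm y"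
    proof (cases "y = 0")
      case False
      \<comment> \<open>\<open>z\<close> has length \<open>r\<close>, so \<open>x\<close> and
        \<open>x + z\<close> both lie in the ball. Thus \<open>T i z\<close> is a difference of two
        vectors of norm at most \<open>n\<close>, whence the factor 2.\<close>
      define z where "z = (r / norm y) *\<^sub>R y"
      have "x + z \<in> F n" "x \<in> F n"
        using r \<open>r > 0\<close> False by (auto simp: z_def dist_norm intro!: subsetD[OF r])
      moreover have "T i z = T i (x + z) - T i x"
        by (simp add: blinfun.add_right)
      ultimately have "norm (T i z) \<le> 2 * real n"
        using norm_triangle_ineq4[of "T i (x + z)" "T i x"]
        by (auto simp: F_def dest!: spec[of _ i])
      then show ?thesis
        using \<open>r > 0\<close> False by (simp add: z_def blinfun.scaleR_right field_simps)
    qed simp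
  qed (use \<open>r > 0\<close> in simp)
  then show ?thesis by blast
qed

lemma cocycle_Suc:
  assumes "cocycle f A"
  shows "A q (Suc n) = A ((f ^^ n) q) 1 o\<^sub>L A q n"
proof -
  have "A q (1 + n) = A ((f ^^ n) q) 1 o\<^sub>L A q n"
    using assms unfolding cocycle_def by blast
  then show ?thesis by simp
qed

lemma cocycle_generator_continuous: "cocycle f A \<Longrightarrow> continuous_on UNIV (\<lambda>q. A q 1 x)"
  unfolding cocycle_def by blast

lemma cocycle_generator_bounded:
  fixes A :: "'m::topological_space \<Rightarrow> nat \<Rightarrow> ('x::banach \<Rightarrow>\<^sub>L 'x)"
  assumes "compact (UNIV :: 'm set)" "cocycle f A"
  shows "\<exists>K. \<forall>q. norm (A q 1) \<le> K"
proof (rule uniform_boundedness)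
  fix x
  have "compact (range (\<lambda>q. A q 1 x))"
    using assms by (intro compact_continuous_image cocycle_generator_continuous)
  then have "bounded (range (\<lambda>q. A q 1 x))"
    by (rule compact_imp_bounded)
  then show "\<exists>K. \<forall>q. norm (A q 1 x) \<le> K"
    by (auto simp: bounded_iff)
qed

text \<open>The uniform bound \<open>K\<close> controls the moving argument:
  \<open>T r (g r - g q)\<close> tends to 0, and \<open>T r (g q)\<close> is left to strong
  continuity. This carries strong continuity from the generator to its products.\<close>

lemma continuous_on_bounded_blinfun_apply:
  fixes T :: "'m::topological_space \<Rightarrow> 'x::real_normed_vector \<Rightarrow>\<^sub>L 'y::real_normed_vector"
  assumes "\<And>q. norm (T q) \<le> K" "\<And>x. continuous_on UNIV (\<lambda>q. T q x)"
    and "continuous_on UNIV g"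
  shows "continuous_on UNIV (\<lambda>q. T q (g q))"
  unfolding continuous_on_def
proof
  fix q
  have "((\<lambda>r. T r (g q)) \<longlongrightarrow> T q (g q)) (at q)"
    using assms(2)[of "g q"] by (auto simp: continuous_on_def)
  moreover have "((\<lambda>r. T r (g r - g q)) \<longlongrightarrow> 0) (at q)"
  proof (rule Lim_null_comparison)
    show "\<forall>\<^sub>F r in at q. norm (T r (g r - g q)) \<le> K * norm (g r - g q)"
      using assms(1) by (intro always_eventually allI order_trans[OF norm_blinfun] mult_right_mono) auto
    have "(g \<longlongrightarrow> g q) (at q)" using assms(3) by (auto simp: continuous_on_def)
    then show "((\<lambda>r. K * norm (g r - g q)) \<longlongrightarrow> 0) (at q)"
      by (intro tendsto_mult_right_zero tendsto_norm_zero) (simp add: LIM_zero)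
  qed
  ultimately have "((\<lambda>r. T r (g q) + T r (g r - g q)) \<longlongrightarrow> T q (g q) + 0) (at q)"
    by (rule tendsto_add)
  then show "((\<lambda>r. T r (g r)) \<longlongrightarrow> T q (g q)) (at q)"
    by (simp add: blinfun.diff_right)
qed

lemma continuous_on_funpow:
  assumes "continuous_on UNIV (f :: 'm::topological_space \<Rightarrow> 'm)"
  shows "continuous_on UNIV (f ^^ n)"
  by (induction n) (auto intro: continuous_on_compose2[OF assms] simp: id_def)

lemma cocycle_strongly_continuous:
  fixes A :: "'m::topological_space \<Rightarrow> nat \<Rightarrow> ('x::banach \<Rightarrow>\<^sub>L 'x)"
  assumes "compact (UNIV :: 'm set)" "continuous_on UNIV f" "cocycle f A"
  shows "continuous_on UNIV (\<lambda>q. A q n x)"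
proof (induction n)
  case 0
  have "A q 0 = id_blinfun" for q using assms(3) unfolding cocycle_def by blast
  then show ?case by simp
next
  case (Suc n)
  obtain K where K: "\<And>q. norm (A q 1) \<le> K"
    using cocycle_generator_bounded[OF assms(1,3)] by blast
  have "continuous_on UNIV (\<lambda>q. A ((f ^^ n) q) 1 y)" for y
    using continuous_on_compose2[OF cocycle_generator_continuous[OF assms(3), of y]
        continuous_on_funpow[OF assms(2), of n] subset_UNIV] .
  with K Suc have "continuous_on UNIV (\<lambda>q. A ((f ^^ n) q) 1 (A q n x))"
    using continuous_on_bounded_blinfun_apply
      [where T = "\<lambda>q. A ((f ^^ n) q) 1" and g = "\<lambda>q. A q n x" and K = K] by blast
  moreover have "A ((f ^^ n) q) 1 (A q n x) = A q (Suc n) x" for q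
    using cocycle_Suc[OF assms(3), of q n] by (simp only: blinfun_apply_blinfun_compose)
  ultimately show ?case by (simp only:)
qed

text \<open>As a supremum of continuous functions the norm is lower semicontinuous.\<close>

lemma cocycle_norm_measurable:
  fixes A :: "'m::topological_space \<Rightarrow> nat \<Rightarrow> ('x::banach \<Rightarrow>\<^sub>L 'x)"
  assumes "compact (UNIV :: 'm set)" "continuous_on UNIV f" "cocycle f A"
  shows "(\<lambda>q. norm (A q n)) \<in> borel_measurable borel"
proof (rule borel_measurableI_le)
  fix r
  show "{q \<in> space borel. norm (A q n) \<le> r} \<in> sets borel"
  proof (cases "r \<ge> 0")
    case True
    have "{q. norm (A q n) \<le> r} = (\<Inter>x. {q. norm (A q n x) \<le> r * norm x})"
      by (auto intro!: norm_blinfun_bound[OF True])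
         (meson mult_right_mono norm_blinfun norm_ge_zero order_trans)
    moreover have "closed \<dots>"
      using cocycle_strongly_continuous[OF assms]
      by (intro closed_INT ballI closed_Collect_le continuous_on_norm continuous_on_const)
    ultimately show ?thesis by (simp add: borel_closed)
  next
    case False
    then have "{q. norm (A q n) \<le> r} = {}"
      by (simp add: not_le less_le_trans[OF _ norm_ge_zero])
    then show ?thesis by simp
  qed
qed

lemma cocycle_norm_submult:
  assumes "cocycle f A"
  shows "norm (A q (n + m)) \<le> norm (A ((f ^^ m) q) n) * norm (A q m)"
  using assms norm_blinfun_compose unfolding cocycle_def by metis

lemma cocycle_0: "cocycle f A \<Longrightarrow> A q 0 = id_blinfun"
  unfolding cocycle_def by blast

lemma cocycle_add_apply: "cocycle f A \<Longrightarrow> A q (n + m) x = A ((f ^^ m) q) n (A q m x)"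
  unfolding cocycle_def by simp

lemma largest_lyapunov_exponent_eqI:
  fixes A :: "'m \<Rightarrow> nat \<Rightarrow> ('x::real_normed_vector \<Rightarrow>\<^sub>L 'x)"
  assumes "prob_space \<mu>" "l < \<infinity>"
    and "AE q in \<mu>. (\<lambda>n. ereal (1 / real n) * elog (norm (A q n))) \<longlonglongrightarrow> l"
  shows "largest_lyapunov_exponent \<mu> A = l"
  unfolding largest_lyapunov_exponent_def
proof (rule the_equality)
  interpret prob_space \<mu> by fact
  fix l'
  assume "l' < \<infinity> \<and> (AE q in \<mu>. (\<lambda>n. ereal (1 / real n) * elog (norm (A q n))) \<longlonglongrightarrow> l')"
  then have "AE q in \<mu>. (\<lambda>n. ereal (1 / real n) * elog (norm (A q n))) \<longlonglongrightarrow> l'" ..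
  with assms(3) have "AE q in \<mu>. l' = l"
    by eventually_elim (rule LIMSEQ_unique)
  then show "l' = l" by simp
qed (use assms in blast)

section \<open>Submultiplicative cocycles\<close>

definition visits :: "('m \<Rightarrow> 'm) \<Rightarrow> 'm set \<Rightarrow> nat \<Rightarrow> 'm \<Rightarrow> nat" where
  "visits f S n q = (\<Sum>k<n. of_bool ((f ^^ k) q \<in> S))"

lemma visits_0 [simp]: "visits f S 0 q = 0"
  by (simp add: visits_def)

lemma visits_Suc [simp]: "visits f S (Suc n) q = visits f S n q + of_bool ((f ^^ n) q \<in> S)"
  by (simp add: visits_def)

lemma visits_add: "visits f S (m + n) q = visits f S m q + visits f S n ((f ^^ m) q)"
proof (induction n)
  case (Suc n)
  have "(f ^^ (m + n)) q = (f ^^ n) ((f ^^ m) q)"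
    by (simp add: add.commute[of m] funpow_add)
  with Suc show ?case by simp
qed simp

lemma visits_compl: "visits f (- S) n q + visits f S n q = n"
  by (induction n) auto

text \<open>A discrete intermediate value principle: the count grows by unit steps, and the time at
  which it leaves \<open>j\<close> is a visit.\<close>

lemma visits_attained:
  assumes "j < visits f S n q"
  shows "\<exists>t<n. (f ^^ t) q \<in> S \<and> visits f S t q = j"
  using assms
proof (induction n)
  case (Suc n)
  show ?case
  proof (cases "j < visits f S n q")
    case True
    then show ?thesis using Suc.IH less_SucI by blast
  next
    case False
    with Suc.prems have "(f ^^ n) q \<in> S" "visits f S n q = j"
      by (auto simp: of_bool_def split: if_splits)
    then show ?thesis by blast
  qed
qed simp

text \<open>Stated for real-valued functions so that it covers both the norms of the cocycle and
  \<open>exp (- visits)\<close>. At time 0 only a bound by 1 is asked, since the identity of a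
  trivial space has norm 0.\<close>

locale submultiplicative =
  fixes f :: "'m \<Rightarrow> 'm" and a :: "'m \<Rightarrow> nat \<Rightarrow> real" and B :: real
  assumes nonneg: "0 \<le> a q n"
    and at_0: "a q 0 \<le> 1"
    and submult: "a q (n + m) \<le> a ((f ^^ m) q) n * a q m"
    and at_1: "a q 1 \<le> exp B"
begin

lemma Suc_le: "a q (Suc n) \<le> a (f q) n * exp B"
proof -
  have "a q (Suc n) \<le> a (f q) n * a q 1"
    using submult[of q n 1] by simp
  also have "\<dots> \<le> a (f q) n * exp B"
    by (intro mult_left_mono at_1 nonneg)
  finally show ?thesis .
qed

lemma exp_bound: "a q n \<le> exp (B * n)"
proof (induction n arbitrary: q)
  case (Suc n)
  have "a q (Suc n) \<le> exp (B * n) * exp B"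
    using Suc_le[of q n] Suc[of "f q"] by (meson exp_ge_zero mult_right_mono order_trans)
  then show ?case by (simp add: algebra_simps flip: exp_add)
qed (simp add: at_0)

text \<open>The orbit segment is cut greedily: outside \<open>S\<close> one jumps by a time at most \<open>N\<close> along
  which \<open>a\<close> is as small as wanted, in \<open>S\<close> one moves by a single step, and the last incomplete
  jump costs at most \<open>D * N\<close>.\<close>

lemma greedy_bound:
  fixes c D :: real
  assumes "\<And>q. q \<notin> S \<Longrightarrow> \<exists>k\<in>{1..N}. a q k \<le> exp (c * k)"
  defines "D \<equiv> \<bar>B\<bar> + \<bar>c\<bar>"
  shows "a q n \<le> exp (c * n + D * visits f S n q + D * N)"
proof (induction n arbitrary: q rule: less_induct)
  case (less n)
  \<comment> \<open>A single step in \<open>S\<close>, known only to cost at most \<open>B\<close>,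
    fits into the budget \<open>c\<close> per step plus \<open>D\<close> per visit.\<close>
  have D: "D \<ge> 0" "B \<le> c + D" by (auto simp: D_def)
  consider "n \<le> N" | "n > N" "q \<in> S" | "n > N" "q \<notin> S" by linarith
  then show ?case
  proof cases
    case 1
    have "B * n \<le> c * n + D * n"
      using mult_right_mono[OF D(2), of "real n"] by (simp add: algebra_simps)
    also have "\<dots> \<le> c * n + D * visits f S n q + D * N"
      using 1 D(1) by (simp add: mult_left_mono add_increasing)
    finally show ?thesis
      using exp_bound[of q n] order_trans by fastforce
  next
    case 2
    then obtain m where m: "n = Suc m" by (cases n) auto
    then have "real n = real m + 1" by simp
    have v: "visits f S n q = 1 + visits f S m (f q)"
      using visits_add[of f S 1 m q] 2 by (simp add: m)
    have "a q n \<le> a (f q) m * exp B"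
      unfolding m by (rule Suc_le)
    also have "\<dots> \<le> exp (c * m + D * visits f S m (f q) + D * N) * exp B"
      using less.IH[of m "f q"] by (intro mult_right_mono) (auto simp: m)
    also have "\<dots> \<le> exp (c * n + D * visits f S n q + D * N)"
      using D(2) by (simp add: v \<open>real n = real m + 1\<close> algebra_simps flip: exp_add)
    finally show ?thesis .
  next
    case 3
    then obtain k where k: "k \<in> {1..N}" "a q k \<le> exp (c * k)" using assms by blast
    obtain m where m: "n = k + m" "m < n" using k 3 less_imp_add_positive[of k n] by force
    have "a q n \<le> a ((f ^^ k) q) m * a q k"
      using submult[of q m k] by (simp add: m add.commute)
    also have "\<dots> \<le> exp (c * m + D * visits f S m ((f ^^ k) q) + D * N) * exp (c * k)"
      using less.IH[OF m(2), of "(f ^^ k) q"] k by (intro mult_mono) (auto simp: nonneg)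
    also have "\<dots> \<le> exp (c * n + D * visits f S n q + D * N)"
      using D(1) by (simp add: visits_add m algebra_simps mult_left_mono flip: exp_add)
    finally show ?thesis .
  qed
qed

section \<open>Exponential growth rates\<close>

definition rate :: "'m \<Rightarrow> nat \<Rightarrow> ereal" where
  "rate q n = ereal (1 / real n) * elog (a q n)"

text \<open>The exponential form also covers \<open>a q n = 0\<close>, where the rate is minus
  infinity. At \<open>n = 0\<close> the rate is 0 whatever \<open>a q 0\<close> is, because
  \<open>1 / 0 = 0\<close>.\<close>

lemma rate_le_iff:
  fixes c :: real
  assumes "n > 0"
  shows "rate q n \<le> ereal c \<longleftrightarrow> a q n \<le> exp (c * n)"
proof (cases "a q n = 0")
  case False
  then have "a q n \<le> exp (c * n) \<longleftrightarrow> ln (a q n) \<le> c * n"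
    using nonneg[of q n] by (metis exp_le_cancel_iff exp_ln order_less_le)
  moreover have "ln (a q n) / n \<le> c \<longleftrightarrow> ln (a q n) \<le> c * n"
    using assms by (simp add: pos_divide_le_eq)
  ultimately show ?thesis
    using False by (simp add: rate_def elog_def)
qed (use assms in \<open>simp add: rate_def elog_def\<close>)

lemma less_rate_iff:
  fixes c :: real
  shows "n > 0 \<Longrightarrow> ereal c < rate q n \<longleftrightarrow> exp (c * n) < a q n"
  by (metis rate_le_iff not_le)

lemma liminf_rate_lessD:
  fixes c :: real
  assumes "liminf (rate q) < ereal c"
  shows "\<exists>\<^sub>F n in sequentially. a q n \<le> exp (c * n)"
proof -
  have "\<exists>\<^sub>F n in sequentially. rate q n \<le> ereal c"
  proof (rule ccontr)
    assume "\<not> (\<exists>\<^sub>F n in sequentially. rate q n \<le> ereal c)"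
    then have "\<forall>\<^sub>F n in sequentially. ereal c \<le> rate q n"
      by (auto simp: frequently_def elim!: eventually_mono)
    then have "ereal c \<le> liminf (rate q)" by (rule Liminf_bounded)
    with assms show False by simp
  qed
  moreover have "\<forall>\<^sub>F n in sequentially. rate q n \<le> ereal c \<longrightarrow> a q n \<le> exp (c * n)"
    using eventually_gt_at_top[of 0] by eventually_elim (simp add: rate_le_iff)
  ultimately show ?thesis by (rule frequently_rev_mp)
qed

lemma liminf_rate_leI:
  fixes c :: real
  assumes "\<exists>\<^sub>F n in sequentially. a q n \<le> exp (c * n)"
  shows "liminf (rate q) \<le> ereal c"
proof (rule ccontr)
  assume "\<not> liminf (rate q) \<le> ereal c"
  then have "\<forall>\<^sub>F n in sequentially. ereal c < rate q n"
    by (intro less_LiminfD) auto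
  then have "\<forall>\<^sub>F n in sequentially. exp (c * n) < a q n"
    using eventually_gt_at_top[of 0] by eventually_elim (simp add: less_rate_iff)
  with assms show False
    by (auto simp: frequently_def not_le)
qed

text \<open>Prefixing one step multiplies by at most \<open>exp B\<close>, which is invisible on the
  exponential scale.\<close>

lemma liminf_rate_subinvariant: "liminf (rate q) \<le> liminf (rate (f q))"
proof (rule ccontr)
  assume "\<not> ?thesis"
  then obtain c where c: "liminf (rate (f q)) < ereal c" "ereal c < liminf (rate q)"
    using ereal_dense2 by (metis not_le)
  then obtain d where d: "ereal c < ereal d" "ereal d < liminf (rate q)"
    using ereal_dense2 by blast
  \<comment> \<open>The gap between \<open>c\<close> and \<open>d\<close> pays for the factor
    \<open>exp B\<close> and for the shift from \<open>n\<close> to \<open>Suc n\<close>.\<close>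
  have "\<forall>\<^sub>F n in sequentially. \<bar>B\<bar> + \<bar>d\<bar> \<le> (d - c) * real n"
    using d(1) by real_asymp
  then have "\<forall>\<^sub>F n in sequentially. a (f q) n \<le> exp (c * n) \<longrightarrow> a q (Suc n) \<le> exp (d * Suc n)"
  proof eventually_elim
    case (elim n)
    show ?case
    proof
      assume "a (f q) n \<le> exp (c * n)"
      then have "a q (Suc n) \<le> exp (c * n) * exp B"
        using Suc_le[of q n] by (meson exp_ge_zero mult_right_mono order_trans)
      also have "\<dots> \<le> exp (d * Suc n)"
        using elim by (simp add: algebra_simps flip: exp_add)
      finally show "a q (Suc n) \<le> exp (d * Suc n)" .
    qed
  qed
  with liminf_rate_lessD[OF c(1)]
  have "\<exists>\<^sub>F n in sequentially. a q (Suc n) \<le> exp (d * Suc n)"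
    by (rule frequently_rev_mp)
  then have "\<exists>\<^sub>F n in sequentially. a q n \<le> exp (d * n)"
    unfolding frequently_def eventually_sequentially_Suc[where P = "\<lambda>n. \<not> a q n \<le> exp (d * n)"] .
  with d(2) show False using liminf_rate_leI leD by blast
qed

lemma liminf_rate_le: "liminf (rate q) \<le> ereal B"
  by (intro liminf_rate_leI) (simp add: exp_bound)

end

section \<open>Kingman's theorem for ergodic measures\<close>

locale ergodic_system =
  fixes f :: "'m::topological_space \<Rightarrow> 'm" and \<mu> :: "'m measure"
  assumes ergodic: "ergodic_prob f \<mu>"
begin

sublocale prob_space \<mu>
  using ergodic by (simp add: ergodic_prob_def invariant_prob_def)

lemma sets_eq_borel [measurable_cong]: "sets \<mu> = sets borel"
  using ergodic by (simp add: ergodic_prob_def invariant_prob_def)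

lemma space_eq_UNIV [simp]: "space \<mu> = UNIV"
  using sets_eq_imp_space_eq[OF sets_eq_borel] by simp

lemma prob_UNIV [simp]: "prob UNIV = 1"
  using prob_space by simp

lemma f_measurable [measurable]: "f \<in> measurable \<mu> \<mu>"
  using ergodic by (simp add: ergodic_prob_def invariant_prob_def)

lemma distr_f: "distr \<mu> \<mu> f = \<mu>"
  using ergodic by (simp add: ergodic_prob_def invariant_prob_def)

lemma funpow_measurable [measurable]: "f ^^ n \<in> measurable \<mu> \<mu>"
  by (induction n) auto

lemma distr_funpow: "distr \<mu> \<mu> (f ^^ n) = \<mu>"
proof (induction n)
  case (Suc n)
  then show ?case
    using distr_distr[OF f_measurable funpow_measurable, of n] by (simp add: distr_f comp_def)
qed (simp add: distr_id)

lemma vimage_sets [measurable]: "S \<in> sets \<mu> \<Longrightarrow> (f ^^ n) -` S \<in> sets \<mu>"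
  using measurable_sets[OF funpow_measurable] by simp

lemma measure_vimage:
  assumes "S \<in> sets \<mu>"
  shows "measure \<mu> ((f ^^ n) -` S) = measure \<mu> S"
  using measure_distr[OF funpow_measurable assms, of n] by (simp add: distr_funpow)

lemma AE_orbit:
  assumes "AE q in \<mu>. P q"
  shows "AE q in \<mu>. \<forall>n. P ((f ^^ n) q)"
proof (subst AE_all_countable, rule allI)
  fix n
  show "AE q in \<mu>. P ((f ^^ n) q)"
    using assms by (intro AE_distrD[OF funpow_measurable]) (subst distr_funpow)
qed

text \<open>Ergodicity is given for strictly invariant sets only. The iterated preimages of
  \<open>S\<close> increase and all have the measure of \<open>S\<close>; their union is strictly
  invariant and so has that measure too.\<close>

lemma zero_one:
  assumes "S \<in> sets \<mu>" "S \<subseteq> f -` S"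
  shows "measure \<mu> S = 0 \<or> measure \<mu> S = 1"
proof -
  define E where "E = (\<Union>n. (f ^^ n) -` S)"
  have mono: "incseq (\<lambda>n. (f ^^ n) -` S)"
    using assms(2) by (intro incseq_SucI) auto
  have "f -` E = E"
  proof (intro equalityI subsetI)
    fix q assume "q \<in> f -` E"
    then obtain n where "(f ^^ Suc n) q \<in> S" by (auto simp: E_def funpow_swap1)
    then show "q \<in> E" unfolding E_def by blast
  next
    fix q assume "q \<in> E"
    then obtain n where "(f ^^ n) (f q) \<in> S"
      using assms(2) by (auto simp: E_def simp flip: funpow_swap1)
    then show "q \<in> f -` E" by (auto simp: E_def)
  qed
  then have "measure \<mu> E = 0 \<or> measure \<mu> E = 1"
    using ergodic assms(1) by (auto simp: ergodic_prob_def E_def)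
  moreover have "(\<lambda>n. measure \<mu> ((f ^^ n) -` S)) \<longlonglongrightarrow> measure \<mu> E"
    unfolding E_def using assms(1) mono by (intro finite_Lim_measure_incseq) auto
  then have "measure \<mu> E = measure \<mu> S"
    by (simp add: measure_vimage[OF assms(1)] LIMSEQ_const_iff)
  ultimately show ?thesis by simp
qed

lemma subinvariant_AE_const:
  fixes g :: "'m \<Rightarrow> ereal"
  assumes [measurable]: "g \<in> borel_measurable \<mu>" and "\<And>q. g q \<le> g (f q)"
  shows "\<exists>r. AE q in \<mu>. g q = g r"
proof -
  \<comment> \<open>The superlevel sets of \<open>g\<close> are forward invariant, hence null or of
    full measure. Rational levels suffice to separate extended reals and cost only countably many
    null sets.\<close>
  define P where "P x \<longleftrightarrow> (AE q in \<mu>. ereal (of_rat x) < g q)" for x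
  have "AE q in \<mu>. ereal (of_rat x) < g q \<longleftrightarrow> P x" for x
  proof -
    let ?S = "{q \<in> space \<mu>. ereal (of_rat x) < g q}"
    have "measure \<mu> ?S = 0 \<or> measure \<mu> ?S = 1"
      using assms(2) by (intro zero_one) (auto intro: less_le_trans)
    then show ?thesis
    proof
      assume "measure \<mu> ?S = 1"
      then have "AE q in \<mu>. ereal (of_rat x) < g q" by (subst (asm) prob_Collect_eq_1) auto
      then show ?thesis unfolding P_def by auto
    next
      assume "measure \<mu> ?S = 0"
      then have ae: "AE q in \<mu>. \<not> ereal (of_rat x) < g q" by (subst (asm) prob_Collect_eq_0) auto
      have "\<not> P x"
      proof
        assume "P x"
        with ae have "AE q in \<mu>. False" unfolding P_def by eventually_elim simp
        then show False by simp
      qed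
      with ae show ?thesis by simp
    qed
  qed
  then have ae: "AE q in \<mu>. \<forall>x. ereal (of_rat x) < g q \<longleftrightarrow> P x"
    by (simp add: AE_all_countable)
  have "\<exists>r. \<forall>x. ereal (of_rat x) < g r \<longleftrightarrow> P x"
  proof (rule ccontr)
    assume "\<not> ?thesis"
    with ae have "AE q in \<mu>. False" by (elim eventually_mono) blast
    then show False by simp
  qed
  then obtain r where r: "\<And>x. ereal (of_rat x) < g r \<longleftrightarrow> P x" by blast
  from ae have "AE q in \<mu>. g q = g r"
  proof eventually_elim
    case (elim q)
    have "\<not> g q < g r" "\<not> g r < g q"
      using ereal_dense3[of "g q" "g r"] ereal_dense3[of "g r" "g q"] elim r by (auto dest: less_asym)
    then show ?case by simp
  qed
  then show ?thesis ..
qed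

lemma visits_eq_indicator: "real (visits f S n q) = (\<Sum>k<n. indicator ((f ^^ k) -` S) q)"
  by (auto simp: visits_def indicator_def of_bool_def intro!: sum.cong)

lemma visits_measurable [measurable]:
  "S \<in> sets \<mu> \<Longrightarrow> (\<lambda>q. real (visits f S n q)) \<in> borel_measurable \<mu>"
  unfolding visits_eq_indicator by (intro borel_measurable_sum borel_measurable_indicator vimage_sets)

lemma integrable_visits: "S \<in> sets \<mu> \<Longrightarrow> integrable \<mu> (\<lambda>q. real (visits f S n q))"
  unfolding visits_eq_indicator
  by (intro Bochner_Integration.integrable_sum integrable_real_indicator vimage_sets) (auto simp: emeasure_eq_measure)

lemma expectation_visits:
  assumes "S \<in> sets \<mu>"
  shows "expectation (\<lambda>q. real (visits f S n q)) = n * measure \<mu> S"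
proof -
  have "expectation (\<lambda>q. real (visits f S n q)) = (\<Sum>k<n. expectation (indicator ((f ^^ k) -` S)))"
    unfolding visits_eq_indicator
    by (intro Bochner_Integration.integral_sum integrable_real_indicator vimage_sets assms)
       (auto simp: emeasure_eq_measure)
  also have "\<dots> = n * measure \<mu> S"
    by (simp add: measure_vimage assms)
  finally show ?thesis .
qed

end

locale ergodic_submultiplicative = ergodic_system f \<mu> + submultiplicative f a B
  for f :: "'m::topological_space \<Rightarrow> 'm" and \<mu> :: "'m measure" and a B +
  assumes a_measurable [measurable]: "\<And>n. (\<lambda>q. a q n) \<in> borel_measurable \<mu>"
begin

lemma rate_measurable [measurable]: "(\<lambda>q. rate q n) \<in> borel_measurable \<mu>"
  unfolding rate_def elog_def by measurable

lemma liminf_rate_AE_const: "\<exists>r. AE q in \<mu>. liminf (rate q) = liminf (rate r)"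
  by (rule subinvariant_AE_const) (use liminf_rate_subinvariant in auto)

text \<open>The waiting time for a good \<open>k\<close> is finite almost everywhere, so the sets
  where it exceeds \<open>N\<close> decrease to a null set.\<close>

lemma exceptional_set:
  fixes c :: real
  assumes ae: "AE q in \<mu>. \<exists>n\<ge>1. a q n \<le> exp (c * n)" and "\<delta> > 0"
  shows "\<exists>S\<in>sets \<mu>. measure \<mu> S < \<delta> \<and> (\<exists>N. \<forall>q. q \<notin> S \<longrightarrow> (\<exists>k\<in>{1..N}. a q k \<le> exp (c * k)))"
proof -
  define S where "S N = {q \<in> space \<mu>. \<forall>k\<in>{1..N}. \<not> a q k \<le> exp (c * k)}" for N
  have S [measurable]: "S N \<in> sets \<mu>" for N
    unfolding S_def by measurable
  have "decseq S"
    by (intro decseq_SucI) (auto simp: S_def)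
  then have "(\<lambda>N. measure \<mu> (S N)) \<longlonglongrightarrow> measure \<mu> (\<Inter>N. S N)"
    by (intro finite_Lim_measure_decseq) auto
  moreover have "measure \<mu> (\<Inter>N. S N) = 0"
  proof -
    have "AE q in \<mu>. q \<notin> (\<Inter>N. S N)"
      using ae by eventually_elim (force simp: S_def)
    then show ?thesis by (subst prob_eq_0) auto
  qed
  ultimately have "\<forall>\<^sub>F N in sequentially. measure \<mu> (S N) < \<delta>"
    using \<open>\<delta> > 0\<close> by (intro order_tendstoD(2)) auto
  then obtain N where "measure \<mu> (S N) < \<delta>"
    by (auto simp: eventually_sequentially)
  then show ?thesis
    using S by (intro bexI[of _ "S N"]) (auto simp: S_def)
qed

end

text \<open>This is the upper half of Birkhoff's theorem for an indicator function. If the frequency of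
  visits exceeded \<open>e\<close> infinitely often, the greedy bound for \<open>exp (- visits)\<close>
  would give \<open>visits \<ge> e * n - error\<close> everywhere; integrating this contradicts
  \<open>measure \<mu> S < e\<close>.\<close>

lemma (in ergodic_system) visits_upper:
  fixes d :: real
  assumes S: "S \<in> sets \<mu>" and d: "measure \<mu> S < d"
  shows "AE q in \<mu>. \<forall>\<^sub>F n in sequentially. visits f S n q \<le> d * n"
proof -
  define b where "b q n = exp (- real (visits f S n q))" for q n
  interpret b: ergodic_submultiplicative f \<mu> b 0
  proof unfold_locales
    fix q n m
    show "b q (n + m) \<le> b ((f ^^ m) q) n * b q m"
      by (simp add: b_def add.commute[of n m] visits_add flip: exp_add)
    show "(\<lambda>q. b q n) \<in> borel_measurable \<mu>"
      unfolding b_def using S by measurable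
  qed (auto simp: b_def)
  obtain r where r: "AE q in \<mu>. liminf (b.rate q) = liminf (b.rate r)"
    using b.liminf_rate_AE_const by blast
  have "ereal (- d) < liminf (b.rate r)"
  proof (rule ccontr)
    assume "\<not> ?thesis"
    then have le: "liminf (b.rate r) \<le> ereal (- d)" by simp
    \<comment> \<open>The strict gap below \<open>d\<close> turns the bound on the liminf into good
      times for infinitely many \<open>n\<close>; the gap above \<open>measure \<mu> S\<close> gives
      the contradiction.\<close>
    obtain e where e: "measure \<mu> S < e" "e < d" using dense[OF d] by blast
    have "e > 0" using e(1) measure_nonneg[of \<mu> S] by linarith
    have "AE q in \<mu>. \<exists>n\<ge>1. b q n \<le> exp (- e * n)"
      using r
    proof eventually_elim
      case (elim q)
      then have "liminf (b.rate q) < ereal (- e)"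
        using le e(2) by (simp add: le_less_trans)
      then have "\<exists>\<^sub>F n in sequentially. b q n \<le> exp (- e * n)"
        by (rule b.liminf_rate_lessD)
      then show ?case
        by (auto simp: frequently_sequentially)
    qed
    \<comment> \<open>Chosen so that visits to \<open>T\<close> consume at most half of the gap
      between \<open>measure \<mu> S\<close> and \<open>e\<close>.\<close>
    moreover define \<delta> where "\<delta> = (e - measure \<mu> S) / (2 * e)"
    moreover have "\<delta> > 0" using e \<open>e > 0\<close> by (simp add: \<delta>_def)
    ultimately obtain T N where T: "T \<in> sets \<mu>" "measure \<mu> T < \<delta>"
      and N: "\<And>q. q \<notin> T \<Longrightarrow> \<exists>k\<in>{1..N}. b q k \<le> exp (- e * k)"
      using b.exceptional_set[of "- e" \<delta>] by blast
    have ineq: "n * e \<le> n * measure \<mu> S + e * (n * measure \<mu> T) + e * N" for n :: nat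
    proof -
      \<comment> \<open>With \<open>B = 0\<close> and \<open>c = - e\<close> the constant of the
        greedy bound is \<open>D = e\<close>; taking logarithms turns the bound into a lower bound
        for the visits.\<close>
      have "n * e - e * N \<le> real (visits f S n q) + e * visits f T n q" for q
        using b.greedy_bound[of T N "- e" q n] N \<open>e > 0\<close> by (simp add: b_def algebra_simps)
      then have "expectation (\<lambda>q. n * e - e * N)
          \<le> expectation (\<lambda>q. real (visits f S n q) + e * visits f T n q)"
        using S T by (intro integral_mono Bochner_Integration.integrable_add
            integrable_mult_right integrable_visits) auto
      also have "\<dots> = n * measure \<mu> S + e * (n * measure \<mu> T)"
        using S T by (simp add: integrable_visits expectation_visits)
      finally show ?thesis by simp
    qed
    have "n * ((e - measure \<mu> S) / 2) \<le> e * N" for n :: nat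
    proof -
      have "e * (n * measure \<mu> T) \<le> e * (n * \<delta>)"
        using T(2) \<open>e > 0\<close> by (intro mult_left_mono) auto
      also have "\<dots> = n * ((e - measure \<mu> S) / 2)"
        using \<open>e > 0\<close> by (simp add: \<delta>_def field_simps)
      finally show ?thesis using ineq[of n] by (simp add: field_simps)
    qed
    moreover have "(e - measure \<mu> S) / 2 > 0" using e by simp
    then obtain n :: nat where "e * N < n * ((e - measure \<mu> S) / 2)"
      using reals_Archimedean3 by blast
    ultimately show False by (meson not_le)
  qed
  from r show ?thesis
  proof eventually_elim
    case (elim q)
    then have "\<forall>\<^sub>F n in sequentially. ereal (- d) < b.rate q n"
      using \<open>ereal (- d) < liminf (b.rate r)\<close> by (intro less_LiminfD) simp
    then show ?case
      using eventually_gt_at_top[of 0]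
      by eventually_elim (simp add: b.less_rate_iff, simp add: b_def)
  qed
qed

section \<open>From infinitely many good times to convergence of the rates\<close>

context ergodic_submultiplicative
begin

text \<open>The greedy bound loses only through visits to a set of small measure, and
  \<open>visits_upper\<close> makes these visits rare along almost every orbit.\<close>

lemma eventually_le_exp:
  fixes c d :: real
  assumes ae: "AE q in \<mu>. liminf (rate q) < ereal c" and "c < d"
  shows "AE q in \<mu>. \<forall>\<^sub>F n in sequentially. a q n \<le> exp (d * n)"
proof -
  define D where "D = \<bar>B\<bar> + \<bar>c\<bar>"
  have "D \<ge> 0" by (simp add: D_def)
  \<comment> \<open>Half of \<open>d - c\<close> pays for the visits, the other half for the final
    term \<open>D * N\<close>. The \<open>+ 1\<close> avoids dividing by zero.\<close>
  define \<delta> where "\<delta> = (d - c) / (2 * (D + 1))"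
  have "\<delta> > 0" using \<open>c < d\<close> \<open>D \<ge> 0\<close> by (simp add: \<delta>_def)
  have "D * \<delta> \<le> (d - c) / 2"
    using \<open>c < d\<close> \<open>D \<ge> 0\<close> by (simp add: \<delta>_def field_simps)
  have "AE q in \<mu>. \<exists>n\<ge>1. a q n \<le> exp (c * n)"
    using ae
  proof eventually_elim
    case (elim q)
    then show ?case using liminf_rate_lessD[OF elim] by (auto simp: frequently_sequentially)
  qed
  from exceptional_set[OF this \<open>\<delta> > 0\<close>] obtain S N where S: "S \<in> sets \<mu>" "measure \<mu> S < \<delta>"
    and N: "\<And>q. q \<notin> S \<Longrightarrow> \<exists>k\<in>{1..N}. a q k \<le> exp (c * k)"
    by blast
  from visits_upper[OF S] show ?thesis
  proof eventually_elim
    case (elim q)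
    have "\<forall>\<^sub>F n in sequentially. D * N \<le> (d - c) / 2 * real n"
      using \<open>c < d\<close> by real_asymp
    with elim show ?case
    proof eventually_elim
      case (elim n)
      have "D * visits f S n q \<le> D * \<delta> * n"
        using mult_left_mono[OF elim(1) \<open>D \<ge> 0\<close>] by (simp add: mult.assoc)
      also have "\<dots> \<le> (d - c) / 2 * n"
        using \<open>D * \<delta> \<le> (d - c) / 2\<close> by (intro mult_right_mono) auto
      finally have "c * n + D * visits f S n q + D * N \<le> d * n"
        using elim(2) by (simp add: field_simps)
      then show ?case
        using greedy_bound[OF N, where n = n and q = q] unfolding D_def
        by (meson exp_le_cancel_iff order_trans)
    qed
  qed
qed

text \<open>The limit is the almost everywhere constant value of the liminf. Every rational above it
  bounds the limsup almost everywhere, and the rationals are countable.\<close>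

theorem kingman: "\<exists>l<\<infinity>. AE q in \<mu>. rate q \<longlonglongrightarrow> l"
proof -
  obtain r where r: "AE q in \<mu>. liminf (rate q) = liminf (rate r)"
    using liminf_rate_AE_const by blast
  define l where "l = liminf (rate r)"
  have "l \<le> ereal B" using liminf_rate_le by (simp add: l_def)
  then have "l < \<infinity>" by (rule le_less_trans) simp
  have "AE q in \<mu>. l < ereal (of_rat x) \<longrightarrow> limsup (rate q) \<le> ereal (of_rat x)" for x
  proof (cases "l < ereal (of_rat x)")
    case True
    then obtain c where c: "l < ereal c" "c < of_rat x"
      using ereal_dense2 by fastforce
    have "AE q in \<mu>. liminf (rate q) < ereal c"
      using r by eventually_elim (simp add: c(1) flip: l_def)
    from eventually_le_exp[OF this c(2)] show ?thesis
    proof eventually_elim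
      case (elim q)
      then have "\<forall>\<^sub>F n in sequentially. rate q n \<le> ereal (of_rat x)"
        using eventually_gt_at_top[of 0] by eventually_elim (simp add: rate_le_iff)
      then show ?case by (simp add: Limsup_bounded)
    qed
  qed simp
  then have "AE q in \<mu>. \<forall>x. l < ereal (of_rat x) \<longrightarrow> limsup (rate q) \<le> ereal (of_rat x)"
    by (simp add: AE_all_countable)
  with r have "AE q in \<mu>. rate q \<longlonglongrightarrow> l"
  proof eventually_elim
    case (elim q)
    have "limsup (rate q) \<le> l"
      using elim(2) ereal_dense3[of l "limsup (rate q)"] by (meson leD not_le)
    moreover have "liminf (rate q) = l" using elim(1) by (simp add: l_def)
    moreover have "liminf (rate q) \<le> limsup (rate q)" by (simp add: Liminf_le_Limsup)
    ultimately show ?case by (intro Liminf_eq_Limsup) auto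
  qed
  with \<open>l < \<infinity>\<close> show ?thesis by blast
qed

end

section \<open>Exponential decay from summability\<close>

text \<open>Datko's trick: for \<open>k < n\<close> with \<open>f^k q\<close> in \<open>S\<close> one has
  \<open>|A(q,n)x| \<le> K |A(q,k)x|\<close>, and summing \<open>p\<close>-th powers over these \<open>k\<close> bounds
  \<open>|A(q,n)|\<close> by a negative power of the number of visits, uniformly on \<open>S\<close>. So
  between \<open>j\<close> successive visits the norm contracts by a fixed factor.\<close>

lemma visits_decay:
  fixes A :: "'m::topological_space \<Rightarrow> nat \<Rightarrow> ('x::banach \<Rightarrow>\<^sub>L 'x)" and C :: "'m \<Rightarrow> real"
  assumes A: "cocycle f A" and "0 < p" and pos: "\<And>q. 0 < C q"
    and G: "\<And>q k. q \<in> G \<Longrightarrow> (f ^^ k) q \<in> G"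
    and summable: "\<And>q x. q \<in> G \<Longrightarrow> summable (\<lambda>n. norm (A q n x) powr p)"
    and suminf: "\<And>q x. q \<in> G \<Longrightarrow> (\<Sum>n. norm (A q n x) powr p) powr (1 / p) \<le> C q * norm x"
    and "0 < K"
  defines "S \<equiv> {q. C q \<le> K}"
  shows "\<exists>j>0::real. \<forall>q\<in>G. \<forall>n. 0 < visits f S n q \<longrightarrow>
    norm (A q n) \<le> C q * K * exp (1 - real (visits f S n q) / j)"
proof -
  have powr_cancel: "s \<le> t" if "s powr p \<le> t powr p" "0 \<le> t" for s t :: real
    using that \<open>0 < p\<close> powr_less_mono2[of p t s] by (meson leD not_le)
  have sum_le: "(\<Sum>k\<in>J. norm (A q k x) powr p) \<le> (C q * norm x) powr p"
    if "q \<in> G" "finite J" for q x J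
  proof -
    have "(\<Sum>k\<in>J. norm (A q k x) powr p) \<le> (\<Sum>k. norm (A q k x) powr p)"
      using that by (intro sum_le_suminf summable) auto
    also have "\<dots> = ((\<Sum>k. norm (A q k x) powr p) powr (1 / p)) powr p"
      using \<open>0 < p\<close> suminf_nonneg[OF summable[OF that(1), of x]] by (simp add: powr_powr)
    also have "\<dots> \<le> (C q * norm x) powr p"
      using \<open>0 < p\<close> by (intro powr_mono2 suminf that) auto
    finally show ?thesis .
  qed
  have apply_le: "norm (A q n x) \<le> C q * norm x" if "q \<in> G" for q n x
  proof (rule powr_cancel)
    show "norm (A q n x) powr p \<le> (C q * norm x) powr p"
      using sum_le[OF that, of "{n}" x] by simp
    show "0 \<le> C q * norm x" using pos[of q] by simp
  qed
  have norm_le: "norm (A q n) \<le> C q" if "q \<in> G" for q n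
    by (rule norm_blinfun_bound[OF less_imp_le[OF pos] apply_le[OF that]])
  \<comment> \<open>One factor \<open>K\<close> bounds the operators restarted at a visit in
    \<open>S\<close>, the other is the summability bound at the starting point, which lies in
    \<open>S\<close> as well.\<close>
  have visits_le: "real (visits f S n q) * norm (A q n x) powr p \<le> (K * (K * norm x)) powr p"
    if q: "q \<in> G" "q \<in> S" for q n x
  proof -
    have "real (visits f S n q) * norm (A q n x) powr p
        = (\<Sum>k<n. of_bool ((f ^^ k) q \<in> S) * norm (A q n x) powr p)"
      by (simp add: visits_def sum_distrib_right)
    also have "\<dots> \<le> (\<Sum>k<n. K powr p * norm (A q k x) powr p)"
    proof (rule sum_mono)
      fix k assume "k \<in> {..<n}"
      then have *: "A q n x = A ((f ^^ k) q) (n - k) (A q k x)"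
        using cocycle_add_apply[OF A, of q "n - k" k x] by simp
      have "norm (A q n x) \<le> K * norm (A q k x)" if "(f ^^ k) q \<in> S"
        unfolding * using that
        by (intro order_trans[OF apply_le[OF G[OF q(1)]]] mult_right_mono) (auto simp: S_def)
      then show "of_bool ((f ^^ k) q \<in> S) * norm (A q n x) powr p \<le> K powr p * norm (A q k x) powr p"
        using \<open>0 < p\<close> \<open>0 < K\<close> by (auto simp: of_bool_def simp flip: powr_mult intro!: powr_mono2)
    qed
    also have "\<dots> \<le> K powr p * (K * norm x) powr p"
      unfolding sum_distrib_left[symmetric]
    proof (rule mult_left_mono)
      have "(C q * norm x) powr p \<le> (K * norm x) powr p"
        using q pos[of q] \<open>0 < p\<close> by (intro powr_mono2 mult_right_mono) (auto simp: S_def less_imp_le)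
      then show "(\<Sum>k<n. norm (A q k x) powr p) \<le> (K * norm x) powr p"
        using sum_le[OF q(1)] by (meson finite_lessThan order_trans)
    qed simp
    also have "\<dots> = (K * (K * norm x)) powr p"
      using \<open>0 < K\<close> by (simp add: powr_mult)
    finally show ?thesis .
  qed
  \<comment> \<open>With this many visits, \<open>visits_le\<close> forces a contraction by
    \<open>exp (- 1)\<close>.\<close>
  obtain j :: nat where j: "(K * K * exp 1) powr p \<le> j"
    using real_arch_simple by blast
  have "0 < (K * K * exp 1) powr p" using \<open>0 < K\<close> by simp
  with j have "0 < j" using less_le_trans of_nat_0_less_iff by blast
  have step: "norm (A q n) \<le> exp (- 1)" if "q \<in> G" "q \<in> S" "visits f S n q = j" for q n
  proof (rule norm_blinfun_bound)
    fix x
    have "(K * K * exp 1) powr p * norm (A q n x) powr p \<le> real j * norm (A q n x) powr p"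
      by (intro mult_right_mono j) simp
    also have "\<dots> \<le> (K * (K * norm x)) powr p"
      using visits_le[OF that(1,2), of n x] that(3) by simp
    finally have "(K * K * exp 1 * norm (A q n x)) powr p \<le> (K * (K * norm x)) powr p"
      using \<open>0 < K\<close> by (simp add: powr_mult)
    then have "K * K * exp 1 * norm (A q n x) \<le> K * (K * norm x)"
      by (rule powr_cancel) (use \<open>0 < K\<close> in simp)
    then have "K * K * (exp 1 * norm (A q n x)) \<le> K * K * norm x"
      by (simp only: mult.assoc)
    then have "exp 1 * norm (A q n x) \<le> norm x"
      by (rule mult_left_le_imp_le) (use \<open>0 < K\<close> in simp)
    then have "exp (- 1) * (exp 1 * norm (A q n x)) \<le> exp (- 1) * norm x"
      by (intro mult_left_mono) auto
    moreover have "exp (- 1) * exp 1 = (1 :: real)"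
      by (simp flip: exp_add)
    ultimately show "norm (A q n x) \<le> exp (- 1) * norm x"
      by (simp only: mult.assoc[symmetric] mult_1)
  qed simp
  \<comment> \<open>The orbit is cut at every \<open>j\<close>-th visit, each block contributing
    \<open>exp (- 1)\<close>. The 1 in the exponent covers the last, incomplete block, where only
    the bound \<open>K\<close> is available.\<close>
  have on_S: "norm (A q n) \<le> K * exp (1 - real (visits f S n q) / j)" if "q \<in> G" "q \<in> S" for q n
    using that
  proof (induction n arbitrary: q rule: less_induct)
    case (less n)
    show ?case
    proof (cases "visits f S n q \<le> j")
      case True
      then have "1 \<le> exp (1 - real (visits f S n q) / j)"
        using \<open>0 < j\<close> by simp
      then have "K \<le> K * exp (1 - real (visits f S n q) / j)"
        using \<open>0 < K\<close> by simp
      moreover have "norm (A q n) \<le> K"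
        using norm_le[OF less.prems(1), of n] less.prems(2) by (simp add: S_def)
      ultimately show ?thesis by linarith
    next
      case False
      then obtain t where t: "t < n" "(f ^^ t) q \<in> S" "visits f S t q = j"
        using visits_attained[of j f S n q] by auto
      have "0 < t" using t(3) \<open>0 < j\<close> by (cases t) auto
      define m where "m = n - t"
      have m: "n = t + m" "m < n" using t(1) \<open>0 < t\<close> by (auto simp: m_def)
      have v: "real (visits f S n q) = j + visits f S m ((f ^^ t) q)"
        unfolding m(1) visits_add t(3) by simp
      have "norm (A q n) \<le> norm (A ((f ^^ t) q) m) * norm (A q t)"
        using cocycle_norm_submult[OF A, of q m t] by (simp add: m(1) add.commute)
      also have "\<dots> \<le> (K * exp (1 - real (visits f S m ((f ^^ t) q)) / j)) * exp (- 1)"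
        using less.prems t(2,3) m(2) \<open>0 < K\<close> by (intro mult_mono less.IH step G) auto
      also have "\<dots> = K * exp (1 - real (visits f S n q) / j)"
        unfolding v using \<open>0 < j\<close> by (simp add: field_simps flip: exp_add)
      finally show ?thesis .
    qed
  qed
  \<comment> \<open>Outside \<open>S\<close> one first waits for the visit with count 0, at the
    price of a factor \<open>C q\<close>.\<close>
  have "norm (A q n) \<le> C q * K * exp (1 - real (visits f S n q) / j)"
    if q: "q \<in> G" "0 < visits f S n q" for q n
  proof -
    obtain t where t: "t < n" "(f ^^ t) q \<in> S" "visits f S t q = 0"
      using visits_attained[OF q(2)] by auto
    define m where "m = n - t"
    have m: "n = t + m" using t(1) by (auto simp: m_def)
    have v: "visits f S n q = visits f S m ((f ^^ t) q)"
      unfolding m visits_add t(3) by simp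
    have "norm (A q n) \<le> norm (A ((f ^^ t) q) m) * norm (A q t)"
      using cocycle_norm_submult[OF A, of q m t] by (simp add: m add.commute)
    also have "\<dots> \<le> (K * exp (1 - real (visits f S m ((f ^^ t) q)) / j)) * C q"
      using q(1) t(2) \<open>0 < K\<close> by (intro mult_mono on_S norm_le G) auto
    finally show ?thesis by (simp add: v mult_ac)
  qed
  with \<open>0 < j\<close> show ?thesis by (intro exI[of _ "real j"]) simp
qed

section \<open>Summability along orbits and the sign of the exponent\<close>

theorem theorem1:
  fixes f :: "'m::metric_space \<Rightarrow> 'm"
    and A :: "'m \<Rightarrow> nat \<Rightarrow> ('x::banach \<Rightarrow>\<^sub>L 'x)"
    and \<mu> :: "'m measure"
  assumes "compact (UNIV :: 'm set)"
    and "continuous_on UNIV f"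
    and "separable_space (euclidean :: 'x topology)"
    and "cocycle f A"
    and "ergodic_prob f \<mu>"
  shows "(\<exists>(C :: 'm \<Rightarrow> real) (p :: real).
            C \<in> borel_measurable borel \<and> (\<forall>q. 0 < C q) \<and> 0 < p \<and>
            (AE q in \<mu>. \<forall>x.
               summable (\<lambda>n. norm (blinfun_apply (A q n) x) powr p) \<and>
               (\<Sum>n. norm (blinfun_apply (A q n) x) powr p) powr (1 / p) \<le> C q * norm x))
         \<longleftrightarrow> largest_lyapunov_exponent \<mu> A < 0"
proof -
  define a where "a q n = norm (A q n)" for q n
  obtain K where K: "\<And>q. norm (A q 1) \<le> K"
    using cocycle_generator_bounded[OF assms(1,4)] by blast
  interpret ergodic_system f \<mu> by unfold_locales fact
  interpret ergodic_submultiplicative f \<mu> a K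
  proof unfold_locales
    fix q n m
    show "a q 0 \<le> 1"
      unfolding a_def cocycle_0[OF assms(4)] by (rule norm_blinfun_id_le)
    show "a q (n + m) \<le> a ((f ^^ m) q) n * a q m"
      unfolding a_def by (rule cocycle_norm_submult[OF assms(4)])
    \<comment> \<open>Since \<open>1 + K \<le> exp K\<close>, the bound \<open>K\<close> itself can
      serve as the logarithmic constant.\<close>
    show "a q 1 \<le> exp K"
      using K[of q] exp_ge_add_one_self[of K] unfolding a_def by linarith
    show "(\<lambda>q. a q n) \<in> borel_measurable \<mu>"
      using cocycle_norm_measurable[OF assms(1,2,4), of n]
      by (simp add: a_def measurable_cong_sets[OF sets_eq_borel refl])
  qed (simp add: a_def)
  obtain l where l: "l < \<infinity>" "AE q in \<mu>. rate q \<longlonglongrightarrow> l" using kingman by blast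
  have exponent: "largest_lyapunov_exponent \<mu> A = l"
    using l by (intro largest_lyapunov_exponent_eqI prob_space_axioms) (auto simp: rate_def[abs_def] a_def)
  show ?thesis
    unfolding exponent
  proof
    assume "\<exists>(C :: 'm \<Rightarrow> real) (p :: real).
            C \<in> borel_measurable borel \<and> (\<forall>q. 0 < C q) \<and> 0 < p \<and>
            (AE q in \<mu>. \<forall>x.
               summable (\<lambda>n. norm (blinfun_apply (A q n) x) powr p) \<and>
               (\<Sum>n. norm (blinfun_apply (A q n) x) powr p) powr (1 / p) \<le> C q * norm x)"
    then obtain C :: "'m \<Rightarrow> real" and p :: real
      where C: "C \<in> borel_measurable borel" "\<And>q. 0 < C q" "0 < p"
        and ae: "AE q in \<mu>. \<forall>x. summable (\<lambda>n. norm (A q n x) powr p) \<and>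
               (\<Sum>n. norm (A q n x) powr p) powr (1 / p) \<le> C q * norm x"
      by blast
    have [measurable]: "C \<in> borel_measurable \<mu>"
      using C(1) by (simp add: measurable_cong_sets[OF sets_eq_borel refl])
    define P where "P q \<longleftrightarrow> (\<forall>x. summable (\<lambda>n. norm (A q n x) powr p) \<and>
               (\<Sum>n. norm (A q n x) powr p) powr (1 / p) \<le> C q * norm x)" for q
    \<comment> \<open>The decay argument uses the summability bound at later points of the orbit
      too, so one passes to a forward invariant set of full measure.\<close>
    define G where "G = {q. \<forall>k. P ((f ^^ k) q)}"
    have ae_G: "AE q in \<mu>. q \<in> G"
      using AE_orbit[of P] ae by (simp add: G_def P_def)
    have G: "(f ^^ k) q \<in> G" if "q \<in> G" for q k
    proof -
      have "P ((f ^^ m) ((f ^^ k) q))" for m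
        using that funpow_add[of m k f] by (auto simp: G_def dest: spec[of _ "m + k"])
      then show ?thesis by (simp add: G_def)
    qed
    have "P q" if "q \<in> G" for q
      using that by (auto simp: G_def dest: spec[of _ 0])
    then have G0: "summable (\<lambda>n. norm (A q n x) powr p)"
        "(\<Sum>n. norm (A q n x) powr p) powr (1 / p) \<le> C q * norm x" if "q \<in> G" for q x
      using that by (simp_all add: P_def)
    define S where "S R = {q. C q \<le> real R}" for R :: nat
    have S [measurable]: "S R \<in> sets \<mu>" for R
    proof -
      have "{q \<in> space \<mu>. C q \<le> real R} \<in> sets \<mu>" by measurable
      then show ?thesis by (simp add: S_def)
    qed
    have "(\<lambda>R. measure \<mu> (S R)) \<longlonglongrightarrow> measure \<mu> (\<Union>R. S R)"
      by (intro finite_Lim_measure_incseq) (auto simp: S_def incseq_def)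
    moreover have "(\<Union>R. S R) = UNIV"
      using real_arch_simple by (auto simp: S_def)
    ultimately have "\<forall>\<^sub>F R in sequentially. 1 / 2 < measure \<mu> (S R)"
      by (intro order_tendstoD(1)) auto
    then have "\<forall>\<^sub>F R in sequentially. 1 / 2 < measure \<mu> (S R) \<and> 0 < R"
      using eventually_gt_at_top[of 0] by eventually_elim simp
    then obtain R where R: "1 / 2 < measure \<mu> (S R)" "0 < R"
      by (auto simp: eventually_sequentially)
    have "\<exists>j>0. \<forall>q\<in>G. \<forall>n. 0 < visits f (S R) n q \<longrightarrow>
        norm (A q n) \<le> C q * real R * exp (1 - real (visits f (S R) n q) / j)"
      unfolding S_def using R(2) by (intro visits_decay[OF assms(4) C(3,2) G G0]) auto
    then obtain j :: real where j: "0 < j" "\<And>q n. q \<in> G \<Longrightarrow> 0 < visits f (S R) n q \<Longrightarrow>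
        a q n \<le> C q * real R * exp (1 - real (visits f (S R) n q) / j)"
      unfolding a_def by blast
    \<comment> \<open>\<open>visits_upper\<close> bounds frequencies from above only; applied to the
      complement it yields at least \<open>n / 2\<close> visits to \<open>S R\<close>.\<close>
    have "measure \<mu> (- S R) < 1 / 2"
      using R(1) prob_compl[OF S[of R]] by (simp add: Compl_eq_Diff_UNIV)
    then have "AE q in \<mu>. \<forall>\<^sub>F n in sequentially. visits f (- S R) n q \<le> 1 / 2 * real n"
      using S[of R] sets.compl_sets[of "S R" \<mu>] by (intro visits_upper) (auto simp: Compl_eq_Diff_UNIV)
    with l(2) ae_G have "AE q in \<mu>. l \<le> ereal (- 1 / (4 * j))"
    proof eventually_elim
      case (elim q)
      have "\<forall>\<^sub>F n in sequentially. C q * real R * exp (1 - n / (2 * j)) \<le> exp (- 1 / (4 * j) * real n)"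
      proof -
        \<comment> \<open>Having \<open>n / 2\<close> visits gives decay at rate
          \<open>2 * g\<close>; half of this rate is given up to absorb the constant factor.\<close>
        define g where "g = 1 / (4 * j)"
        have "0 < g" using j(1) by (simp add: g_def)
        then have "\<forall>\<^sub>F n in sequentially. C q * real R * exp 1 \<le> exp (g * real n)"
          by real_asymp
        then show ?thesis
        proof eventually_elim
          case (elim n)
          have "C q * real R * exp (1 - n / (2 * j)) = (C q * real R * exp 1) * exp (- (2 * g * n))"
            by (simp add: g_def exp_diff exp_minus field_simps)
          also have "\<dots> \<le> exp (g * n) * exp (- (2 * g * n))"
            using elim by (intro mult_right_mono) auto
          also have "\<dots> = exp (- 1 / (4 * j) * n)"
            by (simp add: g_def flip: exp_add)
          finally show ?case .
        qed
      qed
      with elim(3) have "\<forall>\<^sub>F n in sequentially. rate q n \<le> ereal (- 1 / (4 * j))"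
        using eventually_gt_at_top[of 0]
      proof eventually_elim
        case (elim n)
        have "real n = visits f (- S R) n q + visits f (S R) n q"
          using visits_compl[of f "S R" n q] by linarith
        then have v: "n / 2 \<le> visits f (S R) n q" using elim(1) by simp
        then have "0 < visits f (S R) n q" using elim(3) by (auto intro: Nat.gr0I)
        then have "a q n \<le> C q * real R * exp (1 - real (visits f (S R) n q) / j)"
          by (intro j(2) \<open>q \<in> G\<close>)
        also have "\<dots> \<le> C q * real R * exp (1 - n / (2 * j))"
          using v j(1) C(2)[of q] by (intro mult_left_mono) (auto simp: field_simps)
        also have "\<dots> \<le> exp (- 1 / (4 * j) * real n)" by (rule elim(2))
        finally show ?case using elim(3) by (simp add: rate_le_iff)
      qed
      with elim(1) show ?case
        by (rule tendsto_upperbound) simp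
    qed
    then have "l \<le> ereal (- 1 / (4 * j))" by simp
    also have "\<dots> < 0" using j(1) by simp
    finally show "l < 0" .
  next
    assume "l < 0"
    then obtain c where c: "l < ereal c" "c < 0"
      using ereal_dense2[of l 0] by auto
    \<comment> \<open>Summing in \<open>ennreal\<close> makes \<open>C\<close> measurable without
      regard to convergence. Where the sum is infinite \<open>enn2real\<close> returns 0, and adding
      1 keeps \<open>C\<close> positive everywhere.\<close>
    define C where "C q = 1 + enn2real (\<Sum>n. ennreal (a q n))" for q
    have "C \<in> borel_measurable \<mu>" unfolding C_def by measurable
    then have "C \<in> borel_measurable borel"
      by (simp add: measurable_cong_sets[OF sets_eq_borel refl])
    moreover have "0 < C q" for q by (simp add: C_def add_pos_nonneg)
    moreover have "AE q in \<mu>. \<forall>x. summable (\<lambda>n. norm (A q n x) powr 1) \<and>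
               (\<Sum>n. norm (A q n x) powr 1) powr (1 / 1) \<le> C q * norm x"
      using l(2)
    proof eventually_elim
      case (elim q)
      have "\<forall>\<^sub>F n in sequentially. rate q n < ereal c"
        using elim c(1) by (rule order_tendstoD(2))
      then have "\<forall>\<^sub>F n in sequentially. norm (a q n) \<le> exp c ^ n"
        using eventually_gt_at_top[of 0]
      proof eventually_elim
        case (elim n)
        then have "a q n \<le> exp (c * n)" by (simp add: less_imp_le flip: rate_le_iff)
        then show ?case using nonneg[of q n] by (simp add: mult.commute flip: exp_of_nat_mult)
      qed
      then have summable: "summable (a q)"
        by (rule summable_comparison_test_ev) (use c(2) in \<open>simp add: summable_geometric\<close>)
      then have C: "C q = 1 + (\<Sum>n. a q n)"
        using nonneg by (simp add: C_def suminf_ennreal2 suminf_nonneg)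
      show ?case
      proof
        fix x
        have le: "norm (A q n x) \<le> a q n * norm x" for n
          unfolding a_def by (rule norm_blinfun)
        have sx: "summable (\<lambda>n. norm (A q n x))"
          by (rule summable_comparison_test'[OF summable_mult2[OF summable, of "norm x"]])
             (use le in simp)
        have "(\<Sum>n. norm (A q n x)) \<le> (\<Sum>n. a q n * norm x)"
          by (intro suminf_le le sx summable_mult2 summable)
        also have "\<dots> \<le> C q * norm x"
          unfolding C suminf_mult2[OF summable, symmetric] by (simp add: distrib_right)
        finally show "summable (\<lambda>n. norm (A q n x) powr 1) \<and>
               (\<Sum>n. norm (A q n x) powr 1) powr (1 / 1) \<le> C q * norm x"
          using sx by (simp add: suminf_nonneg)
      qed
    qed
    ultimately show "\<exists>(C :: 'm \<Rightarrow> real) (p :: real).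
            C \<in> borel_measurable borel \<and> (\<forall>q. 0 < C q) \<and> 0 < p \<and>
            (AE q in \<mu>. \<forall>x.
               summable (\<lambda>n. norm (blinfun_apply (A q n) x) powr p) \<and>
               (\<Sum>n. norm (blinfun_apply (A q n) x) powr p) powr (1 / p) \<le> C q * norm x)"
      by (intro exI[of _ C] exI[of _ 1]) auto
  qed
qed

end
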